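(* In the locker room problem with $n$ lockers, there is a strategy for Alice and Bob such that, for every sought number $s\in\{0,\dots,n-1\}$, Bob finds card $s$ with probability at least $$\frac{(1+o(1))\,\log n}{n\,\log\log n},$$ where $o(1)$ denotes a quantity depending only on $n$ and tending to $0$ as $n\to\infty$.
   Context: $\log=\log_2$. Locker room problem: there are $n$ lockers numbered $0,\dots,n-1$, into which $n$ cards numbered $0,\dots,n-1$ are placed, one per locker, according to a uniformly random permutation $\sigma$ (locker $\ell$ contains card $\sigma(\ell)$). Alice sees the contents of all lockers and may then swap the cards of one pair of lockers, or leave everything unchanged; she does not know $s$. Then Bob, who does not know $\sigma$, is given $s\in\{0,\dots,n-1\}$ and may open at most two lockers, the choice of the second being allowed to depend on $s$ and on the card seen in the first. Bob succeeds if one of the opened lockers contains card $s$. Alice and Bob agree on a strategy (Alice's swap as a function of $\sigma$; Bob's first locker as a function of $s$; Bob's second locker as a function of $s$ and the card seen in the first locker) beforehand. The probability is over $\sigma$ and any randomness of the strategy. *)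

theory Defs
  imports
    "HOL-Probability.Probability"
    "HOL-Combinatorics.Permutations"
begin

text \<open>
  Lockers and cards are the numbers below \<open>n\<close>. An arrangement \<open>\<sigma>\<close> is a permutation of
  \<open>{..<n}\<close>; locker \<open>l\<close> contains card \<open>\<sigma> l\<close>.
\<close>

type_synonym arrangement = "nat \<Rightarrow> nat"

text \<open>
  Alice names the two lockers whose cards are exchanged; naming the same locker twice leaves
  everything unchanged.
\<close>

type_synonym alice_strategy = "arrangement \<Rightarrow> nat \<times> nat"

text \<open>
  Bob's first locker is a function of the sought number, his second one a function of the sought
  number and the card seen in the first locker. Opening the same locker twice amounts to opening
  only one.
\<close>

type_synonym bob_strategy = "(nat \<Rightarrow> nat) \<times> (nat \<Rightarrow> nat \<Rightarrow> nat)"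

definition alice_strategies :: "nat \<Rightarrow> alice_strategy set" where
  "alice_strategies n =
     {a. \<forall>\<sigma>. \<sigma> permutes {..<n} \<longrightarrow> a \<sigma> \<in> {..<n} \<times> {..<n}}"

definition bob_strategies :: "nat \<Rightarrow> bob_strategy set" where
  "bob_strategies n =
     {(first, second). \<forall>s<n. first s < n \<and> (\<forall>c<n. second s c < n)}"

definition after_swap :: "alice_strategy \<Rightarrow> arrangement \<Rightarrow> arrangement" where
  "after_swap a \<sigma> = (case a \<sigma> of (i, j) \<Rightarrow> \<sigma> \<circ> Transposition.transpose i j)"

definition bob_succeeds :: "bob_strategy \<Rightarrow> arrangement \<Rightarrow> nat \<Rightarrow> bool" where
  "bob_succeeds b \<tau> s =
     (case b of (first, second) \<Rightarrow>
        \<tau> (first s) = s \<or> \<tau> (second s (\<tau> (first s))) = s)"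

text \<open>
  Strategies may be randomised: Alice and Bob each draw a strategy from a distribution agreed on
  beforehand. The two draws and the arrangement are independent, so Alice and Bob share no
  randomness. Deterministic strategies are the point distributions.
\<close>

definition is_strategy :: "nat \<Rightarrow> alice_strategy pmf \<Rightarrow> bob_strategy pmf \<Rightarrow> bool" where
  "is_strategy n A B \<longleftrightarrow>
     set_pmf A \<subseteq> alice_strategies n \<and> set_pmf B \<subseteq> bob_strategies n"

definition success_prob ::
  "nat \<Rightarrow> alice_strategy pmf \<Rightarrow> bob_strategy pmf \<Rightarrow> nat \<Rightarrow> real" where
  "success_prob n A B s =
     measure_pmf.prob
       (pair_pmf (pmf_of_set {\<sigma>. \<sigma> permutes {..<n}}) (pair_pmf A B))
       {(\<sigma>, a, b). bob_succeeds b (after_swap a \<sigma>) s}"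

end

(*
  Call l a hit of the shift h if locker l contains card l + h (mod n). Alice moves the card h of a
  shift with the most hits into locker 0; Bob opens locker 0, reads h there, and opens locker s - h.
  The strategy commutes with conjugation by rotations, so its success probability does not depend
  on s and is at least E[max_h X_h] / n, where X_h is the number of hits of h.

  The maximum is bounded from below by the second moment method applied to Y = sum_h (X_h choose k):
  E[X_h choose m] = 1/m! for m <= n, different shifts are almost uncorrelated, and the diagonal
  terms are controlled by (x choose k)^2 <= 2^x (x choose k). Hence X_h >= k for some h with
  probability 1 - o(1) as long as 2^k k! = o(n) and k^2 = o(n), which allows
  k = (1 - o(1)) ln n / ln ln n.
*)

theory Submission
  imports
    Defs
    "HOL-Number_Theory.Cong"
    "HOL-Real_Asymp.Real_Asymp"
begin

section \<open>Hits of a shift, and rotations\<close>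

definition shift_hits :: "nat \<Rightarrow> nat \<Rightarrow> arrangement \<Rightarrow> nat set" where
  "shift_hits n h \<sigma> = {l. l < n \<and> \<sigma> l = (l + h) mod n}"

abbreviation arrangements :: "nat \<Rightarrow> arrangement set" where
  "arrangements n \<equiv> {\<sigma>. \<sigma> permutes {..<n}}"

lemma finite_arrangements: "finite (arrangements n)"
  by (simp add: finite_permutations)

lemma card_arrangements: "card (arrangements n) = fact n"
  by (simp add: card_permutations)

lemma finite_shift_hits [simp]: "finite (shift_hits n h \<sigma>)"
  by (simp add: shift_hits_def)

lemma shift_hits_subset: "shift_hits n h \<sigma> \<subseteq> {..<n}"
  by (auto simp: shift_hits_def)

lemma card_shift_hits_le: "card (shift_hits n h \<sigma>) \<le> n"
  using card_mono[OF _ shift_hits_subset, of n h \<sigma>] by simp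

text \<open>Cancelling \<open>l\<close> modulo \<open>n\<close> is used in two ways: a locker is a
  hit of at most one shift below \<open>n\<close>, and rotations are injective.\<close>

lemma add_mod_left_inj:
  fixes h h' l n :: nat
  assumes "h < n" "h' < n" "(l + h) mod n = (l + h') mod n"
  shows "h = h'"
proof -
  have "[l + h = l + h'] (mod n)" using assms(3) by (simp add: cong_def)
  hence "[h = h'] (mod n)" by (simp add: cong_add_lcancel_nat)
  thus ?thesis using assms by (simp add: cong_def)
qed

text \<open>The identity outside \<open>{..<n}\<close>, as \<open>permutes\<close> demands. It
  serves both as the arrangement in which every locker is a hit of \<open>t\<close> and as the
  cyclic symmetry of lockers and cards.\<close>

definition rotation :: "nat \<Rightarrow> nat \<Rightarrow> arrangement" where
  "rotation n t l = (if l < n then (l + t) mod n else l)"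

lemma rotation_permutes: "rotation n t permutes {..<n}"
proof (rule bij_imp_permutes)
  have "inj_on (rotation n t) {..<n}"
    by (rule inj_onI) (auto simp: rotation_def add.commute[of _ t] intro: add_mod_left_inj)
  moreover have "rotation n t ` {..<n} \<subseteq> {..<n}"
    by (auto simp: rotation_def)
  ultimately show "bij_betw (rotation n t) {..<n} {..<n}"
    by (simp add: bij_betw_def endo_inj_surj)
qed (auto simp: rotation_def)

section \<open>Counting arrangements with prescribed hits\<close>

text \<open>Composition with \<open>inv \<tau>\<close> turns agreement with \<open>\<tau>\<close> on
  \<open>D\<close> into fixing \<open>D\<close> pointwise, which leaves exactly the permutations of
  \<open>S - D\<close>.\<close>

lemma card_permutes_agreeing:
  assumes "finite S" "D \<subseteq> S" "\<tau> permutes S"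
  shows "card {\<sigma>. \<sigma> permutes S \<and> (\<forall>l\<in>D. \<sigma> l = \<tau> l)} = fact (card S - card D)"
proof -
  have fin: "finite D" using assms finite_subset by blast
  have inv: "inv \<tau> \<circ> \<tau> = id" "\<tau> \<circ> inv \<tau> = id"
    using permutes_inv_o[OF assms(3)] by auto
  have "bij_betw ((\<circ>) \<tau>) {\<pi>. \<pi> permutes (S - D)}
          {\<sigma>. \<sigma> permutes S \<and> (\<forall>l\<in>D. \<sigma> l = \<tau> l)}"
  proof (rule bij_betw_byWitness[where f' = "(\<circ>) (inv \<tau>)"])
    show "\<forall>\<pi>\<in>{\<pi>. \<pi> permutes (S - D)}. inv \<tau> \<circ> (\<tau> \<circ> \<pi>) = \<pi>"
      by (simp add: o_assoc inv)
    show "\<forall>\<sigma>\<in>{\<sigma>. \<sigma> permutes S \<and> (\<forall>l\<in>D. \<sigma> l = \<tau> l)}. \<tau> \<circ> (inv \<tau> \<circ> \<sigma>) = \<sigma>"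
      by (simp add: o_assoc inv)
    show "(\<circ>) \<tau> ` {\<pi>. \<pi> permutes (S - D)} \<subseteq> {\<sigma>. \<sigma> permutes S \<and> (\<forall>l\<in>D. \<sigma> l = \<tau> l)}"
    proof safe
      fix \<pi> assume p: "\<pi> permutes (S - D)"
      hence "\<pi> permutes S" by (rule permutes_subset) auto
      thus "\<tau> \<circ> \<pi> permutes S" using assms(3) by (rule permutes_compose)
      fix l assume "l \<in> D"
      thus "(\<tau> \<circ> \<pi>) l = \<tau> l" using permutes_not_in[OF p, of l] by simp
    qed
    show "(\<circ>) (inv \<tau>) ` {\<sigma>. \<sigma> permutes S \<and> (\<forall>l\<in>D. \<sigma> l = \<tau> l)} \<subseteq> {\<pi>. \<pi> permutes (S - D)}"
    proof safe
      fix \<sigma> assume s: "\<sigma> permutes S" "\<forall>l\<in>D. \<sigma> l = \<tau> l"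
      have "inv \<tau> \<circ> \<sigma> permutes S"
        by (rule permutes_compose[OF s(1) permutes_inv[OF assms(3)]])
      thus "inv \<tau> \<circ> \<sigma> permutes (S - D)"
        by (rule permutes_superset) (use s(2) permutes_inverses[OF assms(3)] in auto)
    qed
  qed
  from bij_betw_same_card[OF this] show ?thesis
    using card_permutations[of "S - D" "card S - card D"] assms fin by (simp add: card_Diff_subset)
qed

lemma double_count:
  assumes "finite A" "finite B"
  shows "(\<Sum>a\<in>A. card {b \<in> B. R a b}) = (\<Sum>b\<in>B. card {a \<in> A. R a b})"
  using sum.swap_restrict[OF assms, of "\<lambda>_ _. 1::nat" R] by simp

text \<open>Makes the family of candidate sets independent of \<open>F\<close>, so that a sum of
  binomials over arrangements can be exchanged with a sum over sets of lockers.\<close>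

lemma binomial_card_subset:
  assumes "finite U" "F \<subseteq> U"
  shows "card F choose m = card {A \<in> {A. A \<subseteq> U \<and> card A = m}. A \<subseteq> F}"
proof -
  have eq: "{A \<in> {A. A \<subseteq> U \<and> card A = m}. A \<subseteq> F} = {A. A \<subseteq> F \<and> card A = m}"
    using assms by auto
  show ?thesis unfolding eq by (rule n_subsets[symmetric]) (rule finite_subset[OF assms(2,1)])
qed

text \<open>An \<open>m\<close>-set of lockers consists of hits iff the arrangement agrees on it
  with \<open>rotation n h\<close>. Divided by \<open>fact n\<close>, the sum is the binomial moment
  \<open>1 / fact m\<close>.\<close>

lemma sum_binomial_shift_hits:
  assumes "m \<le> n"
  shows "(\<Sum>\<sigma>\<in>arrangements n. card (shift_hits n h \<sigma>) choose m) = (n choose m) * fact (n - m)"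
proof -
  let ?Q = "{A. A \<subseteq> {..<n} \<and> card A = m}"
  have finQ: "finite ?Q" by simp
  have "(\<Sum>\<sigma>\<in>arrangements n. card (shift_hits n h \<sigma>) choose m) =
      (\<Sum>\<sigma>\<in>arrangements n. card {A \<in> ?Q. A \<subseteq> shift_hits n h \<sigma>})"
    by (intro sum.cong refl binomial_card_subset shift_hits_subset) simp
  also have "\<dots> = (\<Sum>A\<in>?Q. card {\<sigma> \<in> arrangements n. A \<subseteq> shift_hits n h \<sigma>})"
    by (rule double_count[OF finite_arrangements finQ])
  also have "\<dots> = (\<Sum>A\<in>?Q. fact (n - m))"
  proof (rule sum.cong[OF refl])
    fix A assume A: "A \<in> ?Q"
    have "{\<sigma> \<in> arrangements n. A \<subseteq> shift_hits n h \<sigma>} =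
        {\<sigma>. \<sigma> permutes {..<n} \<and> (\<forall>l\<in>A. \<sigma> l = rotation n h l)}"
      using A by (auto simp: shift_hits_def rotation_def)
    thus "card {\<sigma> \<in> arrangements n. A \<subseteq> shift_hits n h \<sigma>} = fact (n - m)"
      using card_permutes_agreeing[of "{..<n}" A "rotation n h"] A rotation_permutes by auto
  qed
  also have "\<dots> = (n choose m) * fact (n - m)"
    using n_subsets[of "{..<n}" m] by simp
  finally show ?thesis .
qed

text \<open>Extends the moment bound to orders \<open>m\<close> beyond \<open>n\<close>, where the
  sum vanishes; such orders occur in the expansion of the square below.\<close>

lemma sum_binomial_shift_hits_le:
  "(\<Sum>\<sigma>\<in>arrangements n. real (card (shift_hits n h \<sigma>) choose m)) \<le> fact n / fact m"
proof (cases "m \<le> n")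
  case True
  have "(\<Sum>\<sigma>\<in>arrangements n. real (card (shift_hits n h \<sigma>) choose m)) =
      real ((n choose m) * fact (n - m))"
    unfolding sum_binomial_shift_hits[OF True, of h, symmetric] by simp
  also have "\<dots> = fact n / fact m"
    using True by (simp add: binomial_fact)
  finally show ?thesis by simp
next
  case False
  hence "card (shift_hits n h \<sigma>) choose m = 0" for \<sigma>
    using card_shift_hits_le[of n h \<sigma>] by (intro binomial_eq_0) linarith
  hence "(\<Sum>\<sigma>\<in>arrangements n. real (card (shift_hits n h \<sigma>) choose m)) = 0"
    by (intro sum.neutral) simp
  thus ?thesis by simp
qed

text \<open>No locker is a hit of two shifts, so a pair of \<open>k\<close>-sets either cannot be
  realised or is disjoint and prescribes \<open>2 * k\<close> cards. Unrealisable pairs are the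
  reason for the inequality.\<close>

lemma sum_binomial_shift_hits_distinct_le:
  assumes "h < n" "h' < n" "h \<noteq> h'"
  shows "(\<Sum>\<sigma>\<in>arrangements n. (card (shift_hits n h \<sigma>) choose k) * (card (shift_hits n h' \<sigma>) choose k))
      \<le> (n choose k)^2 * fact (n - 2 * k)"
proof -
  let ?Q = "{A. A \<subseteq> {..<n} \<and> card A = k}"
  have finQ: "finite (?Q \<times> ?Q)" by simp
  have "(\<Sum>\<sigma>\<in>arrangements n. (card (shift_hits n h \<sigma>) choose k) * (card (shift_hits n h' \<sigma>) choose k)) =
      (\<Sum>\<sigma>\<in>arrangements n. card {p \<in> ?Q \<times> ?Q. fst p \<subseteq> shift_hits n h \<sigma> \<and> snd p \<subseteq> shift_hits n h' \<sigma>})"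
  proof (rule sum.cong[OF refl])
    fix \<sigma>
    have "{p \<in> ?Q \<times> ?Q. fst p \<subseteq> shift_hits n h \<sigma> \<and> snd p \<subseteq> shift_hits n h' \<sigma>} =
        {A \<in> ?Q. A \<subseteq> shift_hits n h \<sigma>} \<times> {A \<in> ?Q. A \<subseteq> shift_hits n h' \<sigma>}"
      by auto
    thus "(card (shift_hits n h \<sigma>) choose k) * (card (shift_hits n h' \<sigma>) choose k) =
        card {p \<in> ?Q \<times> ?Q. fst p \<subseteq> shift_hits n h \<sigma> \<and> snd p \<subseteq> shift_hits n h' \<sigma>}"
      using binomial_card_subset[OF finite_lessThan shift_hits_subset, of n h \<sigma> k]
        binomial_card_subset[OF finite_lessThan shift_hits_subset, of n h' \<sigma> k]
      by (simp only: card_cartesian_product)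
  qed
  also have "\<dots> = (\<Sum>p\<in>?Q \<times> ?Q. card {\<sigma> \<in> arrangements n.
      fst p \<subseteq> shift_hits n h \<sigma> \<and> snd p \<subseteq> shift_hits n h' \<sigma>})"
    by (rule double_count[OF finite_arrangements finQ])
  also have "\<dots> \<le> (\<Sum>p\<in>?Q \<times> ?Q. fact (n - 2 * k))"
  proof (rule sum_mono)
    fix p assume p: "p \<in> ?Q \<times> ?Q"
    obtain A B where AB: "p = (A, B)" by (cases p)
    let ?E = "{\<sigma> \<in> arrangements n. A \<subseteq> shift_hits n h \<sigma> \<and> B \<subseteq> shift_hits n h' \<sigma>}"
    have "card ?E \<le> fact (n - 2 * k)"
    proof (cases "?E = {}")
      case True
      thus ?thesis by (simp only: card.empty)
    next
      case False
      \<comment> \<open>One realising arrangement serves as the reference: all others agree with it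
        on \<open>A \<union> B\<close>.\<close>
      then obtain \<tau> where \<tau>: "\<tau> permutes {..<n}" "A \<subseteq> shift_hits n h \<tau>" "B \<subseteq> shift_hits n h' \<tau>"
        by auto
      have "A \<inter> B = {}"
        using \<tau> add_mod_left_inj[OF assms(1,2)] assms(3) by (fastforce simp: shift_hits_def)
      moreover have "finite A" "finite B" "A \<subseteq> {..<n}" "B \<subseteq> {..<n}" "card A = k" "card B = k"
        using p AB by (auto intro: finite_subset)
      ultimately have *: "card (A \<union> B) = 2 * k" "A \<union> B \<subseteq> {..<n}"
        by (auto simp: card_Un_disjoint)
      have "?E \<subseteq> {\<sigma>. \<sigma> permutes {..<n} \<and> (\<forall>l\<in>A \<union> B. \<sigma> l = \<tau> l)}"
        using \<tau> by (auto simp: shift_hits_def subset_iff)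
      moreover have "finite {\<sigma>. \<sigma> permutes {..<n} \<and> (\<forall>l\<in>A \<union> B. \<sigma> l = \<tau> l)}"
        by (rule finite_subset[OF _ finite_arrangements[of n]]) auto
      ultimately have "card ?E \<le> card {\<sigma>. \<sigma> permutes {..<n} \<and> (\<forall>l\<in>A \<union> B. \<sigma> l = \<tau> l)}"
        by (rule card_mono[rotated])
      also have "\<dots> = fact (n - 2 * k)"
        using card_permutes_agreeing[OF finite_lessThan *(2) \<tau>(1)] *(1) by simp
      finally show ?thesis .
    qed
    thus "card {\<sigma> \<in> arrangements n. fst p \<subseteq> shift_hits n h \<sigma> \<and> snd p \<subseteq> shift_hits n h' \<sigma>}
        \<le> fact (n - 2 * k)"
      using AB by simp
  qed
  also have "\<dots> = (n choose k)^2 * fact (n - 2 * k)"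
    using n_subsets[of "{..<n}" k] by (simp add: card_cartesian_product power2_eq_square)
  finally show ?thesis .
qed

section \<open>The diagonal terms of the second moment\<close>

text \<open>One factor is at most \<open>2^x = 2^k * 2^(x - k)\<close>. Expanding
  \<open>2^(x - k)\<close> into binomials and merging them with the other factor leaves an
  expression linear in binomials of \<open>x\<close>, whose averages are known. The range up to
  \<open>n\<close> does not depend on \<open>x\<close>.\<close>

lemma binomial_square_le:
  assumes "x \<le> n"
  shows "(x choose k)^2 \<le> 2^k * (\<Sum>j\<le>n. (x choose (k + j)) * ((k + j) choose k))"
proof (cases "k \<le> x")
  case True
  have "x choose k \<le> (\<Sum>i\<le>x. x choose i)"
    by (rule member_le_sum) (use True in auto)
  also have "\<dots> = 2^x" by (rule choose_row_sum)
  also have "\<dots> = 2^k * 2^(x - k)" using True by (simp flip: power_add)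
  also have "(2::nat)^(x - k) = (\<Sum>j\<le>x - k. (x - k) choose j)"
    by (rule choose_row_sum[symmetric])
  also have "\<dots> \<le> (\<Sum>j\<le>n. (x - k) choose j)"
    by (rule sum_mono2) (use assms in auto)
  finally have "x choose k \<le> 2^k * (\<Sum>j\<le>n. (x - k) choose j)" by simp
  hence "(x choose k)^2 \<le> (x choose k) * (2^k * (\<Sum>j\<le>n. (x - k) choose j))"
    by (simp add: power2_eq_square)
  also have "\<dots> = 2^k * (\<Sum>j\<le>n. (x choose k) * ((x - k) choose j))"
    by (simp add: sum_distrib_left mult.left_commute)
  also have "(\<Sum>j\<le>n. (x choose k) * ((x - k) choose j)) =
      (\<Sum>j\<le>n. (x choose (k + j)) * ((k + j) choose k))"
  proof (rule sum.cong[OF refl])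
    fix j
    show "(x choose k) * ((x - k) choose j) = (x choose (k + j)) * ((k + j) choose k)"
    proof (cases "k + j \<le> x")
      case True
      thus ?thesis using choose_mult[of k "k + j" x] by simp
    next
      case False
      thus ?thesis using \<open>k \<le> x\<close> by (simp add: binomial_eq_0)
    qed
  qed
  finally show ?thesis .
qed (simp add: binomial_eq_0)

lemma sum_inverse_fact_le: "(\<Sum>j\<le>n. 1 / fact j) \<le> (3::real)"
proof -
  have "(\<Sum>j\<le>n. 1 / fact j) = (\<Sum>j<Suc n. 1 ^ j /\<^sub>R fact j :: real)"
    by (rule sum.cong) (auto simp: field_simps)
  also have "\<dots> \<le> exp 1"
    unfolding exp_def by (rule sum_le_suminf) (use summable_exp[of "1::real"] in auto)
  also have "\<dots> \<le> 3" by (rule exp_le)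
  finally show ?thesis .
qed

text \<open>After averaging, the \<open>j\<close>-th term of the expansion is
  \<open>((k + j) choose k) / fact (k + j) = 1 / (fact k * fact j)\<close>, and the sum over
  \<open>j\<close> is at most \<open>exp 1 \<le> 3\<close>.\<close>

lemma sum_binomial_shift_hits_square_le:
  "(\<Sum>\<sigma>\<in>arrangements n. real (card (shift_hits n h \<sigma>) choose k)^2) \<le> 3 * 2^k * fact n / fact k"
proof -
  let ?X = "\<lambda>\<sigma>. card (shift_hits n h \<sigma>)"
  have "(\<Sum>\<sigma>\<in>arrangements n. real (?X \<sigma> choose k)^2) \<le>
      (\<Sum>\<sigma>\<in>arrangements n. 2^k * (\<Sum>j\<le>n. real (?X \<sigma> choose (k + j)) * real ((k + j) choose k)))"
  proof (rule sum_mono)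
    fix \<sigma>
    have "real ((?X \<sigma> choose k)^2) \<le> real (2^k * (\<Sum>j\<le>n. (?X \<sigma> choose (k + j)) * ((k + j) choose k)))"
      by (rule of_nat_mono, rule binomial_square_le, rule card_shift_hits_le)
    thus "real (?X \<sigma> choose k)^2 \<le>
        2^k * (\<Sum>j\<le>n. real (?X \<sigma> choose (k + j)) * real ((k + j) choose k))"
      by simp
  qed
  also have "\<dots> = 2^k * (\<Sum>j\<le>n. \<Sum>\<sigma>\<in>arrangements n. real (?X \<sigma> choose (k + j)) * real ((k + j) choose k))"
    unfolding sum_distrib_left[symmetric] by (subst sum.swap) simp
  also have "\<dots> = 2^k * (\<Sum>j\<le>n. (\<Sum>\<sigma>\<in>arrangements n. real (?X \<sigma> choose (k + j))) * real ((k + j) choose k))"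
    by (simp only: sum_distrib_right)
  also have "\<dots> \<le> 2^k * (\<Sum>j\<le>n. fact n / fact (k + j) * real ((k + j) choose k))"
    by (intro mult_left_mono sum_mono mult_right_mono sum_binomial_shift_hits_le) auto
  also have "\<dots> = 2^k * (\<Sum>j\<le>n. fact n / fact k * (1 / fact j))"
  proof (rule arg_cong2[where f = "(*)", OF refl sum.cong[OF refl]])
    fix j
    show "fact n / fact (k + j) * real ((k + j) choose k) = (fact n / fact k * (1 / fact j) :: real)"
      using binomial_fact[of k "k + j", where 'a = real] by simp
  qed
  also have "\<dots> = 2^k * (fact n / fact k) * (\<Sum>j\<le>n. 1 / fact j)"
    by (simp only: sum_distrib_left mult.assoc)
  also have "\<dots> \<le> 2^k * (fact n / fact k) * 3"
    by (intro mult_left_mono sum_inverse_fact_le) auto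
  finally show ?thesis by (simp add: field_simps)
qed

section \<open>Correlation of different shifts, and the second moment bound\<close>

text \<open>With \<open>fact_add_le_power\<close>, this encloses the product of the \<open>k\<close>
  factors from \<open>m + 1\<close> to \<open>m + k\<close> between \<open>m^k\<close> and
  \<open>(m + k)^k\<close>.\<close>

lemma power_times_fact_le: "m^k * fact m \<le> (fact (m + k) :: nat)"
proof (induction k)
  case (Suc k)
  have "m^Suc k * fact m = m * (m^k * fact m)" by simp
  also have "\<dots> \<le> (m + Suc k) * fact (m + k)" by (rule mult_mono) (use Suc in auto)
  finally show ?case by simp
qed simp

lemma fact_add_le_power: "(fact (m + k) :: nat) \<le> (m + k)^k * fact m"
proof (induction k)
  case (Suc k)
  have "(fact (m + Suc k) :: nat) = (m + Suc k) * fact (m + k)" by simp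
  also have "\<dots> \<le> (m + Suc k) * ((m + k)^k * fact m)" using Suc by (intro mult_left_mono) auto
  also have "\<dots> \<le> (m + Suc k) * ((m + Suc k)^k * fact m)"
    by (intro mult_left_mono mult_right_mono power_mono) auto
  finally show ?case by (simp only: power_Suc mult.assoc)
qed simp

text \<open>The left side is the bound on the mixed moment of two shifts divided by the product of
  their means. With \<open>m = n - 2 * k\<close> it is at most
  \<open>(n / m)^k = (1 + 2 * k / m)^k\<close>, which is close to 1 when \<open>k^2\<close> is small
  against \<open>n\<close>.\<close>

lemma pair_correlation_le:
  assumes "2 * k < n"
  shows "(real (n choose k) * fact k)^2 * fact (n - 2 * k) / fact n \<le> exp (2 * real k^2 / (real n - 2 * real k))"
proof -
  define m where "m = n - 2 * k"
  have n: "n = m + k + k" and m: "0 < m" using assms by (auto simp: m_def)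
  have 1: "real (fact n) \<le> real (n^k * fact (m + k))"
    unfolding n by (rule of_nat_mono, rule fact_add_le_power)
  have 2: "real (m^k * fact m) \<le> real (fact (m + k))"
    by (rule of_nat_mono, rule power_times_fact_le)
  have "real (n choose k) * fact k = fact n / fact (m + k)"
    using binomial_fact[of k n, where 'a = real] by (simp add: n)
  hence "(real (n choose k) * fact k)^2 * fact (n - 2 * k) / fact n = (fact n / fact (m + k)) * (fact m / fact (m + k))"
    by (simp add: m_def power2_eq_square)
  also have "\<dots> \<le> (real n^k) * (1 / real m^k)"
    by (intro mult_mono) (use 1 2 m in \<open>auto simp: field_simps\<close>)
  also have "\<dots> = (1 + 2 * real k / real m)^k"
    using m by (simp add: n field_simps)
  also have "\<dots> \<le> exp (2 * real k / real m)^k"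
    by (intro power_mono exp_ge_add_one_self) auto
  also have "\<dots> = exp (2 * real k^2 / real m)"
    by (simp add: exp_of_nat_mult[symmetric] power2_eq_square field_simps)
  also have "real m = real n - 2 * real k" using n by simp
  finally show ?thesis .
qed

text \<open>Cauchy-Schwarz for \<open>Y\<close> and the indicator of \<open>G\<close>. The two
  summands in the bracket bound the diagonal and the off-diagonal share of the second moment of
  \<open>Y\<close> relative to its squared mean.\<close>

lemma card_large_shift_hits_ge:
  assumes "2 * k < n"
  shows "real (card {\<sigma> \<in> arrangements n. \<exists>h<n. k \<le> card (shift_hits n h \<sigma>)}) *
      (3 * 2^k * fact k / real n + exp (2 * real k^2 / (real n - 2 * real k))) \<ge> fact n"
proof -
  define P where "P = arrangements n"
  define G where "G = {\<sigma> \<in> P. \<exists>h<n. k \<le> card (shift_hits n h \<sigma>)}"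
  define c where "c h \<sigma> = real (card (shift_hits n h \<sigma>) choose k)" for h \<sigma>
  define Y where "Y \<sigma> = (\<Sum>h<n. c h \<sigma>)" for \<sigma>
  define e where "e = exp (2 * real k^2 / (real n - 2 * real k))"
  define F :: real where "F = fact n"
  define K :: real where "K = fact k"
  have [simp]: "finite P" unfolding P_def by (rule finite_arrangements)
  have n: "0 < n" and kn: "k \<le> n" using assms by auto
  have pos: "F > 0" "K > 0" by (auto simp: F_def K_def)
  have sum1: "(\<Sum>\<sigma>\<in>P. c h \<sigma>) = F / K" for h
  proof -
    have "(\<Sum>\<sigma>\<in>P. c h \<sigma>) = real ((n choose k) * fact (n - k))"
      unfolding sum_binomial_shift_hits[OF kn, of h, symmetric] c_def P_def by simp
    thus ?thesis using kn by (simp add: binomial_fact F_def K_def)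
  qed
  have sumY: "(\<Sum>\<sigma>\<in>P. Y \<sigma>) = n * (F / K)"
    unfolding Y_def by (subst sum.swap) (simp add: sum1)
  have off: "(\<Sum>\<sigma>\<in>P. c h \<sigma> * c h' \<sigma>) \<le> (F / K^2) * e"
    if "h < n" "h' < n" "h \<noteq> h'" for h h'
  proof -
    have "(\<Sum>\<sigma>\<in>P. c h \<sigma> * c h' \<sigma>) = real (\<Sum>\<sigma>\<in>arrangements n.
        (card (shift_hits n h \<sigma>) choose k) * (card (shift_hits n h' \<sigma>) choose k))"
      by (simp add: c_def P_def)
    also have "\<dots> \<le> real ((n choose k)^2 * fact (n - 2 * k))"
      by (rule of_nat_mono, rule sum_binomial_shift_hits_distinct_le[OF that])
    also have "\<dots> = (F / K^2) * ((real (n choose k) * fact k)^2 * fact (n - 2 * k) / fact n)"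
      by (simp add: F_def K_def field_simps)
    also have "\<dots> \<le> (F / K^2) * e"
      unfolding e_def using pos by (intro mult_left_mono pair_correlation_le assms) auto
    finally show ?thesis .
  qed
  have diag: "(\<Sum>\<sigma>\<in>P. c h \<sigma> * c h \<sigma>) \<le> 3 * 2^k * F / K" for h
    using sum_binomial_shift_hits_square_le[where h = h and k = k and n = n]
    by (simp add: c_def P_def F_def K_def power2_eq_square)
  have "(\<Sum>\<sigma>\<in>P. (Y \<sigma>)^2) = (\<Sum>h<n. \<Sum>h'<n. \<Sum>\<sigma>\<in>P. c h \<sigma> * c h' \<sigma>)"
  proof -
    have "(\<Sum>\<sigma>\<in>P. (Y \<sigma>)^2) = (\<Sum>\<sigma>\<in>P. \<Sum>h<n. \<Sum>h'<n. c h \<sigma> * c h' \<sigma>)"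
      by (simp add: Y_def power2_eq_square sum_product)
    also have "\<dots> = (\<Sum>h<n. \<Sum>\<sigma>\<in>P. \<Sum>h'<n. c h \<sigma> * c h' \<sigma>)" by (rule sum.swap)
    also have "\<dots> = (\<Sum>h<n. \<Sum>h'<n. \<Sum>\<sigma>\<in>P. c h \<sigma> * c h' \<sigma>)"
      by (rule sum.cong[OF refl], rule sum.swap)
    finally show ?thesis .
  qed
  \<comment> \<open>The off-diagonal bound is granted to the diagonal entries too, which makes the
    double sum uniform.\<close>
  also have "\<dots> \<le> (\<Sum>h<n. \<Sum>h'<n. (if h = h' then 3 * 2^k * F / K else 0) + (F / K^2) * e)"
  proof (intro sum_mono)
    fix h h' assume "h \<in> {..<n}" "h' \<in> {..<n}"
    moreover have "0 \<le> (F / K^2) * e" using pos by (simp add: e_def)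
    ultimately show "(\<Sum>\<sigma>\<in>P. c h \<sigma> * c h' \<sigma>) \<le> (if h = h' then 3 * 2^k * F / K else 0) + (F / K^2) * e"
      using off[of h h'] diag[of h] by auto
  qed
  also have "\<dots> = n * (3 * 2^k * F / K) + n^2 * ((F / K^2) * e)"
    by (simp add: sum.distrib power2_eq_square algebra_simps)
  also have "\<dots> = (n^2 * F / K^2) * (3 * 2^k * K / n + e)"
    using n pos by (simp add: field_simps power2_eq_square)
  finally have sumY2: "(\<Sum>\<sigma>\<in>P. (Y \<sigma>)^2) \<le> (n^2 * F / K^2) * (3 * 2^k * K / n + e)" .
  \<comment> \<open>Outside \<open>G\<close> every shift has fewer than \<open>k\<close> hits, so
    all binomials vanish.\<close>
  have "(\<Sum>\<sigma>\<in>P. Y \<sigma>) = (\<Sum>\<sigma>\<in>G. Y \<sigma>)"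
  proof (rule sum.mono_neutral_right)
    show "\<forall>\<sigma>\<in>P - G. Y \<sigma> = 0"
      by (auto simp: G_def Y_def c_def not_le intro!: sum.neutral)
  qed (auto simp: G_def)
  hence "(n * (F / K))^2 = (\<Sum>\<sigma>\<in>G. 1 * Y \<sigma>)^2" by (simp add: sumY)
  also have "\<dots> \<le> (\<Sum>\<sigma>\<in>G. 1^2) * (\<Sum>\<sigma>\<in>G. (Y \<sigma>)^2)" by (rule Cauchy_Schwarz_ineq_sum)
  also have "\<dots> \<le> card G * (\<Sum>\<sigma>\<in>P. (Y \<sigma>)^2)"
    by (auto intro!: mult_left_mono sum_mono2 simp: G_def)
  also have "\<dots> \<le> card G * ((n^2 * F / K^2) * (3 * 2^k * K / n + e))"
    by (intro mult_left_mono sumY2) auto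
  also have "\<dots> = (n^2 * F / K^2) * (card G * (3 * 2^k * K / n + e))" by (rule mult.left_commute)
  also have "(n * (F / K))^2 = (n^2 * F / K^2) * F" by (simp add: power2_eq_square)
  finally have "(n^2 * F / K^2) * F \<le> (n^2 * F / K^2) * (card G * (3 * 2^k * K / n + e))" .
  hence "F \<le> card G * (3 * 2^k * K / n + e)"
    by (rule mult_left_le_imp_le) (use n pos in auto)
  thus ?thesis by (simp add: F_def K_def G_def P_def e_def)
qed

section \<open>Rotation symmetry\<close>

text \<open>The predicate under \<open>SOME\<close> sees \<open>\<sigma>\<close> only through its
  hit counts. Hence arrangements with equal counts get the same shift even when there are
  ties.\<close>

definition best_shift :: "nat \<Rightarrow> arrangement \<Rightarrow> nat" where
  "best_shift n \<sigma> =
     (SOME h. h < n \<and> (\<forall>h'<n. card (shift_hits n h' \<sigma>) \<le> card (shift_hits n h \<sigma>)))"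

lemma
  assumes "0 < n"
  shows best_shift_less: "best_shift n \<sigma> < n"
    and best_shift_max: "h < n \<Longrightarrow> card (shift_hits n h \<sigma>) \<le> card (shift_hits n (best_shift n \<sigma>) \<sigma>)"
proof -
  have "\<exists>h. h < n \<and> (\<forall>h'. h' < n \<longrightarrow> card (shift_hits n h' \<sigma>) \<le> card (shift_hits n h \<sigma>))"
    by (rule ex_has_greatest_nat[of "\<lambda>h. h < n" 0 _ "Suc n"])
       (use assms in \<open>auto simp: less_Suc_eq_le card_shift_hits_le\<close>)
  from someI_ex[OF this]
  show "best_shift n \<sigma> < n"
    "h < n \<Longrightarrow> card (shift_hits n h \<sigma>) \<le> card (shift_hits n (best_shift n \<sigma>) \<sigma>)"
    unfolding best_shift_def by blast+
qed

text \<open>Conjugation renumbers lockers and cards by the same rotation.\<close>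

definition rotate_arrangement :: "nat \<Rightarrow> nat \<Rightarrow> arrangement \<Rightarrow> arrangement" where
  "rotate_arrangement n t \<sigma> = rotation n t \<circ> \<sigma> \<circ> inv (rotation n t)"

lemma rotate_arrangement_permutes:
  assumes "\<sigma> permutes {..<n}"
  shows "rotate_arrangement n t \<sigma> permutes {..<n}"
  unfolding rotate_arrangement_def
  by (intro permutes_compose permutes_inv rotation_permutes assms)

lemma rotate_arrangement_rotation:
  "rotate_arrangement n t \<sigma> (rotation n t l) = rotation n t (\<sigma> l)"
  by (simp add: rotate_arrangement_def permutes_inverses[OF rotation_permutes])

lemma inj_rotate_arrangement: "inj (rotate_arrangement n t)"
proof (rule injI)
  fix \<sigma> \<sigma>' assume eq: "rotate_arrangement n t \<sigma> = rotate_arrangement n t \<sigma>'"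
  have "rotation n t (\<sigma> l) = rotation n t (\<sigma>' l)" for l
    using rotate_arrangement_rotation[of n t \<sigma> l] rotate_arrangement_rotation[of n t \<sigma>' l] eq by simp
  thus "\<sigma> = \<sigma>'"
    using permutes_inj[OF rotation_permutes[of n t]] by (auto simp: inj_eq)
qed

lemma rotation_add_mod:
  assumes "l < n"
  shows "(rotation n t l + h) mod n = rotation n t ((l + h) mod n)"
  using assms by (simp add: rotation_def mod_simps ac_simps)

text \<open>Locker and card move by the same amount, so their difference, the shift, is
  kept.\<close>

lemma shift_hits_rotate_arrangement:
  "shift_hits n h (rotate_arrangement n t \<sigma>) = rotation n t ` shift_hits n h \<sigma>"
proof -
  let ?c = "rotation n t"
  note perm = rotation_permutes[of n t]
  have iff: "?c l \<in> shift_hits n h (rotate_arrangement n t \<sigma>) \<longleftrightarrow> l \<in> shift_hits n h \<sigma>" for l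
    using permutes_in_image[OF perm, of l]
    by (auto simp: shift_hits_def rotate_arrangement_rotation rotation_add_mod
        inj_eq[OF permutes_inj[OF perm]])
  show ?thesis
  proof safe
    fix l assume "l \<in> shift_hits n h (rotate_arrangement n t \<sigma>)"
    moreover have "?c (inv ?c l) = l" by (rule permutes_inverses[OF perm])
    ultimately show "l \<in> ?c ` shift_hits n h \<sigma>"
      using iff[of "inv ?c l"] by (metis imageI)
  qed (simp add: iff)
qed

lemma best_shift_rotate_arrangement:
  "best_shift n (rotate_arrangement n t \<sigma>) = best_shift n \<sigma>"
proof -
  have "card (shift_hits n h (rotate_arrangement n t \<sigma>)) = card (shift_hits n h \<sigma>)" for h
    unfolding shift_hits_rotate_arrangement
    by (intro card_image inj_on_subset[OF permutes_inj[OF rotation_permutes]]) simp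
  thus ?thesis unfolding best_shift_def by simp
qed

text \<open>Sufficient for Bob's success but not necessary: he also succeeds when \<open>s\<close>
  is itself the best shift.\<close>

definition hitting_arrangements :: "nat \<Rightarrow> nat \<Rightarrow> arrangement set" where
  "hitting_arrangements n s =
     {\<sigma> \<in> arrangements n. \<exists>l\<in>shift_hits n (best_shift n \<sigma>) \<sigma>. \<sigma> l = s}"

lemma card_hitting_arrangements_rotate_le:
  assumes "s < n"
  shows "card (hitting_arrangements n s) \<le> card (hitting_arrangements n ((s + t) mod n))"
proof (rule card_inj_on_le[where f = "rotate_arrangement n t"])
  show "inj_on (rotate_arrangement n t) (hitting_arrangements n s)"
    by (rule inj_on_subset[OF inj_rotate_arrangement]) simp
  show "rotate_arrangement n t ` hitting_arrangements n s \<subseteq> hitting_arrangements n ((s + t) mod n)"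
  proof safe
    fix \<sigma> assume "\<sigma> \<in> hitting_arrangements n s"
    then obtain l where \<sigma>: "\<sigma> permutes {..<n}" and l: "l \<in> shift_hits n (best_shift n \<sigma>) \<sigma>" "\<sigma> l = s"
      by (auto simp: hitting_arrangements_def)
    have "rotate_arrangement n t \<sigma> (rotation n t l) = (s + t) mod n"
      using assms l unfolding rotate_arrangement_rotation by (simp add: rotation_def)
    thus "rotate_arrangement n t \<sigma> \<in> hitting_arrangements n ((s + t) mod n)"
      using l(1) rotate_arrangement_permutes[OF \<sigma>]
      by (auto simp: hitting_arrangements_def best_shift_rotate_arrangement shift_hits_rotate_arrangement)
  qed
  show "finite (hitting_arrangements n ((s + t) mod n))"
    by (rule finite_subset[OF _ finite_arrangements[of n]]) (auto simp: hitting_arrangements_def)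
qed

text \<open>By rotation the count is the same for all \<open>n\<close> sought numbers, so
  \<open>n\<close> times one count is the sum over all of them. For a fixed arrangement, distinct
  hits hold distinct cards.\<close>

lemma card_hitting_arrangements:
  assumes "s < n"
  shows "n * card (hitting_arrangements n s) =
    (\<Sum>\<sigma>\<in>arrangements n. card (shift_hits n (best_shift n \<sigma>) \<sigma>))"
proof -
  have le: "card (hitting_arrangements n s) \<le> card (hitting_arrangements n s')" if "s < n" "s' < n" for s s'
  proof -
    \<comment> \<open>\<open>s' + n - s\<close> represents the difference \<open>s' - s\<close>
      modulo \<open>n\<close> without truncated subtraction.\<close>
    have "(s + (s' + n - s)) mod n = s'" using that by simp
    thus ?thesis using card_hitting_arrangements_rotate_le[OF that(1), of "s' + n - s"] by simp
  qed
  have "n * card (hitting_arrangements n s) = (\<Sum>s'<n. card (hitting_arrangements n s))" by simp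
  also have "\<dots> = (\<Sum>s'<n. card (hitting_arrangements n s'))"
    by (rule sum.cong) (auto intro!: antisym le assms)
  also have "\<dots> = (\<Sum>\<sigma>\<in>arrangements n. card {s \<in> {..<n}. \<exists>l\<in>shift_hits n (best_shift n \<sigma>) \<sigma>. \<sigma> l = s})"
    unfolding hitting_arrangements_def by (rule double_count) (auto simp: finite_arrangements)
  also have "\<dots> = (\<Sum>\<sigma>\<in>arrangements n. card (shift_hits n (best_shift n \<sigma>) \<sigma>))"
  proof (rule sum.cong[OF refl])
    fix \<sigma> assume "\<sigma> \<in> arrangements n"
    hence \<sigma>: "\<sigma> permutes {..<n}" by simp
    let ?S = "shift_hits n (best_shift n \<sigma>) \<sigma>"
    have "{s \<in> {..<n}. \<exists>l\<in>?S. \<sigma> l = s} = \<sigma> ` ?S"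
      using permutes_in_image[OF \<sigma>] shift_hits_subset by fastforce
    thus "card {s \<in> {..<n}. \<exists>l\<in>?S. \<sigma> l = s} = card ?S"
      by (simp add: card_image inj_on_subset[OF permutes_inj[OF \<sigma>]])
  qed
  finally show ?thesis .
qed

section \<open>The strategy and its success\<close>

definition shift_alice :: "nat \<Rightarrow> alice_strategy" where
  "shift_alice n \<sigma> = (0, inv \<sigma> (best_shift n \<sigma>))"

text \<open>The summand \<open>n\<close> keeps the subtraction of a card \<open>c < n\<close> from
  being truncated.\<close>

definition shift_bob :: "nat \<Rightarrow> bob_strategy" where
  "shift_bob n = ((\<lambda>_. 0), (\<lambda>s c. (s + n - c) mod n))"

lemma shift_strategy_is_strategy:
  assumes "0 < n"
  shows "is_strategy n (return_pmf (shift_alice n)) (return_pmf (shift_bob n))"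
proof -
  have "inv \<sigma> (best_shift n \<sigma>) < n" if "\<sigma> permutes {..<n}" for \<sigma>
    using permutes_in_image[OF permutes_inv[OF that], of "best_shift n \<sigma>"] best_shift_less[OF assms]
    by simp
  thus ?thesis
    using assms
    by (auto simp: is_strategy_def alice_strategies_def bob_strategies_def shift_alice_def shift_bob_def)
qed

text \<open>
  The swap never spoils a hit: the displaced card is the number \<open>h\<close> of the shift itself, which Bob
  finds in locker \<open>0\<close>, and for any other sought card a hit lies neither in locker \<open>0\<close> nor in the
  locker that held \<open>h\<close>.
\<close>

lemma shift_strategy_succeeds:
  assumes "0 < n" "\<sigma> \<in> hitting_arrangements n s"
  shows "bob_succeeds (shift_bob n) (after_swap (shift_alice n) \<sigma>) s"
proof -
  define h where "h = best_shift n \<sigma>"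
  define p where "p = inv \<sigma> h"
  have h: "h < n" unfolding h_def by (rule best_shift_less[OF assms(1)])
  obtain l where \<sigma>: "\<sigma> permutes {..<n}" and l: "l < n" "(l + h) mod n = s" "\<sigma> l = s"
    using assms(2) by (auto simp: hitting_arrangements_def shift_hits_def h_def)
  have p: "\<sigma> p = h" unfolding p_def by (rule permutes_inverses[OF \<sigma>])
  have swap: "after_swap (shift_alice n) \<sigma> = \<sigma> \<circ> Transposition.transpose 0 p"
    by (simp add: after_swap_def shift_alice_def h_def p_def)
  show ?thesis
  proof (cases "s = h")
    case True
    thus ?thesis by (simp add: bob_succeeds_def shift_bob_def swap p)
  next
    case False
    \<comment> \<open>A hit in locker \<open>0\<close> would hold card \<open>h mod n = h\<close>,
      forcing \<open>s = h\<close>.\<close>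
    have "l \<noteq> 0" using False l h by (intro notI) simp
    moreover have "l \<noteq> p" using False l p by auto
    \<comment> \<open>Without wrap-around \<open>s + n - h\<close> is \<open>l + n\<close>; with it,
      it is \<open>l\<close>.\<close>
    moreover have "(s + n - h) mod n = l"
    proof (cases "l + h < n")
      case True
      hence "s + n - h = l + n" using l by simp
      thus ?thesis using l by simp
    next
      case False
      hence "(l + h) mod n = l + h - n" using l(1) h by (subst le_mod_geq) auto
      hence "s = l + h - n" using l(2) by simp
      thus ?thesis using False l by simp
    qed
    ultimately show ?thesis
      by (simp add: bob_succeeds_def shift_bob_def swap p l transpose_apply_other)
  qed
qed

text \<open>For point distributions the product collapses to the uniform distribution on
  arrangements, where the hitting ones all lie in the success event.\<close>

lemma success_prob_ge:
  assumes "0 < n"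
  shows "success_prob n (return_pmf (shift_alice n)) (return_pmf (shift_bob n)) s \<ge>
    real (card (hitting_arrangements n s)) / fact n"
proof -
  let ?P = "arrangements n"
  let ?E = "{\<sigma>. bob_succeeds (shift_bob n) (after_swap (shift_alice n) \<sigma>) s}"
  have ne: "?P \<noteq> {}" using permutes_id by blast
  have "real (card (hitting_arrangements n s)) \<le> real (card (?P \<inter> ?E))"
  proof (intro of_nat_mono card_mono)
    have "hitting_arrangements n s \<subseteq> ?P" by (auto simp: hitting_arrangements_def)
    thus "hitting_arrangements n s \<subseteq> ?P \<inter> ?E"
      using shift_strategy_succeeds[OF assms] by blast
  qed (simp add: finite_arrangements)
  hence "real (card (hitting_arrangements n s)) / fact n \<le> measure_pmf.prob (pmf_of_set ?P) ?E"
    by (simp add: measure_pmf_of_set[OF ne finite_arrangements] card_arrangements divide_right_mono)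
  also have "\<dots> = success_prob n (return_pmf (shift_alice n)) (return_pmf (shift_bob n)) s"
    by (simp add: success_prob_def pair_return_pmf2 vimage_def)
  finally show ?thesis .
qed

section \<open>Choice of the threshold and asymptotics\<close>

text \<open>Each arrangement in \<open>G\<close> contributes at least \<open>k\<close> hits to the
  total, and the second moment bound gives \<open>card G \<ge> fact n / D\<close>.\<close>

lemma success_prob_ge_threshold:
  assumes "2 * k < n" "s < n"
  shows "success_prob n (return_pmf (shift_alice n)) (return_pmf (shift_bob n)) s \<ge>
    real k / (real n * (3 * 2^k * fact k / real n + exp (2 * real k^2 / (real n - 2 * real k))))"
proof -
  define G where "G = {\<sigma> \<in> arrangements n. \<exists>h<n. k \<le> card (shift_hits n h \<sigma>)}"
  define D where "D = 3 * 2^k * fact k / real n + exp (2 * real k^2 / (real n - 2 * real k))"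
  have n: "0 < n" using assms by simp
  have D: "D > 0" unfolding D_def by (intro add_nonneg_pos) auto
  have G: "fact n \<le> real (card G) * D"
    unfolding G_def D_def by (rule card_large_shift_hits_ge[OF assms(1)])
  have "k * card G = (\<Sum>\<sigma>\<in>G. k)" by simp
  also have "\<dots> \<le> (\<Sum>\<sigma>\<in>G. card (shift_hits n (best_shift n \<sigma>) \<sigma>))"
    by (rule sum_mono) (auto simp: G_def intro: order_trans best_shift_max[OF n])
  also have "\<dots> \<le> (\<Sum>\<sigma>\<in>arrangements n. card (shift_hits n (best_shift n \<sigma>) \<sigma>))"
    by (rule sum_mono2) (auto simp: finite_arrangements G_def)
  also have "\<dots> = n * card (hitting_arrangements n s)"
    using card_hitting_arrangements[OF assms(2)] by simp
  finally have "real (k * card G) \<le> real (n * card (hitting_arrangements n s))"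
    by (rule of_nat_mono)
  hence *: "real k * card G \<le> n * card (hitting_arrangements n s)" by simp
  have "real k * fact n \<le> real k * (card G * D)" by (intro mult_left_mono G) auto
  also have "\<dots> = (real k * card G) * D" by simp
  also have "\<dots> \<le> (n * card (hitting_arrangements n s)) * D"
    using D by (intro mult_right_mono *) auto
  finally have "real k / (n * D) \<le> card (hitting_arrangements n s) / fact n"
    using n D by (simp add: field_simps)
  also note success_prob_ge[OF n]
  finally show ?thesis by (simp add: D_def)
qed

text \<open>The threshold bound with \<open>k\<close> eliminated, as an explicit function of a real
  variable that \<open>real_asymp\<close> can treat. The \<open>- 1\<close> in the numerator pays
  for rounding \<open>k\<close> down.\<close>

definition probability_bound :: "real \<Rightarrow> real" where
  "probability_bound x = ((1 - 1 / ln (ln x)) * ln x / ln (ln x) - 1) /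
     (x * (3 * exp (- ln x / ln (ln x)) + exp (2 * ln x^2 / (x - 2 * ln x))))"

lemma success_prob_ge_probability_bound:
  assumes ll: "ln (ln (real n)) \<ge> 2" and n: "real n > 2 * ln (real n)" and s: "s < n"
  shows "success_prob n (return_pmf (shift_alice n)) (return_pmf (shift_bob n)) s \<ge>
    probability_bound (real n)"
proof -
  define L where "L = ln (real n)"
  define M where "M = ln L"
  \<comment> \<open>The factor \<open>1 - 1 / M\<close> gives \<open>y * M = L - L / M\<close>, so
    \<open>exp (y * M)\<close> falls short of \<open>n\<close> by the vanishing factor
    \<open>exp (- L / M)\<close>, while \<open>y\<close> is still asymptotic to
    \<open>L / M\<close>.\<close>
  define y where "y = (1 - 1 / M) * L / M"
  define k where "k = nat \<lfloor>y\<rfloor>"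
  define e where "e = exp (2 * real k^2 / (real n - 2 * real k))"
  have M: "M \<ge> 2" using ll by (simp add: M_def L_def)
  have n0: "real n > 0" using s by simp
  hence L0: "L \<ge> 0" by (simp add: L_def)
  \<comment> \<open>Uses the convention \<open>ln 0 = 0\<close>.\<close>
  have "L \<noteq> 0" using M by (auto simp: M_def)
  hence L: "L > 0" using L0 by simp
  have y0: "y \<ge> 0" using M L by (auto simp: y_def)
  hence ky: "real k \<le> y" "real k \<ge> y - 1" unfolding k_def by linarith+
  have "y \<le> 1 * L / 2" unfolding y_def using M L by (intro frac_le mult_right_mono) auto
  hence k2: "2 * real k \<le> L" using ky by simp
  have kn: "2 * k < n" using k2 n L by (simp add: L_def)
  \<comment> \<open>The crude bound \<open>fact k \<le> k^k\<close> suffices: the power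
    \<open>2^k\<close> is absorbed by \<open>2 * k \<le> L\<close>.\<close>
  have "2^k * fact k \<le> (2^k * real k^k)"
    using fact_le_power[of k, where 'a = real] by simp
  also have "\<dots> = (2 * real k)^k" by (simp add: power_mult_distrib)
  also have "\<dots> \<le> L^k" using k2 by (intro power_mono) auto
  also have "\<dots> = exp (real k * M)" using L by (simp add: M_def exp_of_nat_mult)
  also have "\<dots> \<le> exp (y * M)" using ky M by simp
  also have "y * M = L + - L / M" using M by (simp add: y_def field_simps)
  also have "exp \<dots> = real n * exp (- L / M)" using n0 by (simp only: exp_add) (simp add: L_def)
  finally have "3 * 2^k * fact k / real n \<le> 3 * exp (- L / M)"
    using n0 by (simp add: field_simps)
  moreover have "e \<le> exp (2 * L^2 / (real n - 2 * L))"
    unfolding e_def exp_le_cancel_iff using k2 n L by (intro frac_le mult_left_mono power_mono) (auto simp: L_def)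
  ultimately have D: "3 * 2^k * fact k / real n + e \<le> 3 * exp (- L / M) + exp (2 * L^2 / (real n - 2 * L))"
    by (rule add_mono)
  have pos: "0 < 3 * 2^k * fact k / real n + e" unfolding e_def by (intro add_nonneg_pos) auto
  have "probability_bound (real n) \<le> real k / (real n * (3 * exp (- L / M) + exp (2 * L^2 / (real n - 2 * L))))"
    unfolding probability_bound_def L_def[symmetric] M_def[symmetric] y_def[symmetric]
    using ky n0 by (intro divide_right_mono mult_nonneg_nonneg add_nonneg_nonneg) auto
  also have "\<dots> \<le> real k / (real n * (3 * 2^k * fact k / real n + e))"
    using D pos n0 by (intro divide_left_mono mult_left_mono mult_pos_pos) (auto intro: less_le_trans)
  also note success_prob_ge_threshold[OF kn s, folded e_def]
  finally show ?thesis .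
qed

theorem mainTheorem3:
  "\<exists>\<epsilon> :: nat \<Rightarrow> real. \<epsilon> \<longlonglongrightarrow> 0 \<and>
     (\<forall>n\<ge>3. \<exists>A B. is_strategy n A B \<and>
        (\<forall>s<n. success_prob n A B s
                 \<ge> (1 + \<epsilon> n) * log 2 (real n) / (real n * log 2 (log 2 (real n)))))"
proof -
  define large where "large n \<longleftrightarrow> ln (ln (real n)) \<ge> 2 \<and> real n > 2 * ln (real n)" for n :: nat
  \<comment> \<open>The ratio of the proved bound to the claimed leading term. It tends to 1 in base
    2 as well, since \<open>log 2 n / log 2 (log 2 n)\<close> equals
    \<open>ln n / (ln (ln n) - ln (ln 2))\<close>.\<close>
  define r where "r n = probability_bound (real n) * (real n * log 2 (log 2 (real n)) / log 2 (real n))"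
    for n :: nat
  \<comment> \<open>For the remaining \<open>n\<close> the value \<open>- 1\<close> makes the
    claimed bound zero.\<close>
  define \<epsilon> where "\<epsilon> n = (if large n then r n - 1 else - 1)" for n :: nat
  have "eventually (\<lambda>n. ln (ln (real n)) \<ge> 2) sequentially" by real_asymp
  moreover have "eventually (\<lambda>n. real n > 2 * ln (real n)) sequentially" by real_asymp
  ultimately have "eventually large sequentially"
    unfolding large_def by (rule eventually_conj)
  hence "eventually (\<lambda>n. r n - 1 = \<epsilon> n) sequentially"
    by eventually_elim (simp add: \<epsilon>_def)
  moreover have "(\<lambda>n. r n - 1) \<longlonglongrightarrow> 0"
    unfolding r_def probability_bound_def by real_asymp
  ultimately have lim: "\<epsilon> \<longlonglongrightarrow> 0" by (rule Lim_transform_eventually[rotated])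
  have bound: "success_prob n (return_pmf (shift_alice n)) (return_pmf (shift_bob n)) s
      \<ge> (1 + \<epsilon> n) * log 2 (real n) / (real n * log 2 (log 2 (real n)))" if "n \<ge> 3" "s < n" for n s
  proof (cases "large n")
    case True
    \<comment> \<open>From \<open>n \<ge> 3\<close> both logarithms are nonzero, so that the
      quotient in \<open>r\<close> cancels.\<close>
    have "log 2 (real n) > 1" using that by simp
    moreover from this have "log 2 (log 2 (real n)) > 0"
      using zero_less_log_cancel_iff[of 2 "log 2 (real n)"] by linarith
    ultimately have "log 2 (log 2 (real n)) \<noteq> 0" "log 2 (real n) \<noteq> 0" by linarith+
    hence "(1 + \<epsilon> n) * log 2 (real n) / (real n * log 2 (log 2 (real n))) = probability_bound (real n)"
      using True that by (simp add: \<epsilon>_def r_def)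
    thus ?thesis
      using success_prob_ge_probability_bound[of n s] True that by (simp add: large_def)
  next
    case False
    thus ?thesis by (simp add: \<epsilon>_def success_prob_def)
  qed
  show ?thesis
  proof (intro exI[of _ \<epsilon>] conjI lim allI impI)
    fix n :: nat assume n: "n \<ge> 3"
    show "\<exists>A B. is_strategy n A B \<and> (\<forall>s<n. success_prob n A B s
        \<ge> (1 + \<epsilon> n) * log 2 (real n) / (real n * log 2 (log 2 (real n))))"
    proof (intro exI conjI allI impI)
      show "is_strategy n (return_pmf (shift_alice n)) (return_pmf (shift_bob n))"
        using n by (intro shift_strategy_is_strategy) simp
    qed (rule bound[OF n])
  qed
qed

end
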